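(* For every finite set $T\subset\mathbb{N}$, there exists a non-empty finite set $X\subset S^1$ with $\mathrm{Hst}(X)=T$.
   Context: Identify $S^1$ with $\{z\in\mathbb{C}: |z|=1\}\subset\mathbb{R}^2$. Here $\mathbb{N}=\{1,2,3,\dots\}$. For $d\ge 2$ and $k\in\mathbb{N}$, let $\mathrm{Harm}_k(d)$ denote the space of real homogeneous harmonic polynomials of degree $k$ in $d$ variables. For a non-empty finite set $X\subset S^{d-1}$, its harmonic strength is $\mathrm{Hst}(X)=\{k\in\mathbb{N} : \sum_{\xi\in X}P(\xi)=0 \text{ for all } P\in\mathrm{Harm}_k(d)\}$. For $X\subset S^1$ this equals $\{k\in\mathbb{N}: \sum_{x\in X}x^k=0\}$, where $x^k$ is the complex power. *)

theory Defs
  imports "HOL-Analysis.Analysis"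
begin

text \<open>
  Polynomials over the infinite field of reals are identified with the functions they induce.
  The variables are the coordinates with respect to the orthonormal \<^const>\<open>Basis\<close> of a Euclidean
  space; a multi-index is an extensional function from \<^const>\<open>Basis\<close> to exponents (the upper bound
  \<open>k\<close> on each exponent is no restriction, since the exponents add up to \<open>k\<close>).
  The zero polynomial is homogeneous of every degree.
\<close>

definition homogeneous_polynomial :: "nat \<Rightarrow> ('a::euclidean_space \<Rightarrow> real) \<Rightarrow> bool" where
  "homogeneous_polynomial k P \<longleftrightarrow>
     (\<exists>c :: ('a \<Rightarrow> nat) \<Rightarrow> real. \<forall>x.
        P x = (\<Sum>\<alpha> | \<alpha> \<in> Basis \<rightarrow>\<^sub>E {..k} \<and> sum \<alpha> Basis = k. c \<alpha> * (\<Prod>b\<in>Basis. (x \<bullet> b) ^ \<alpha> b)))"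

definition laplacian :: "('a::euclidean_space \<Rightarrow> real) \<Rightarrow> 'a \<Rightarrow> real" where
  "laplacian f x = (\<Sum>b\<in>Basis. (deriv ^^ 2) (\<lambda>t. f (x + t *\<^sub>R b)) 0)"

definition Harm :: "nat \<Rightarrow> ('a::euclidean_space \<Rightarrow> real) set" where
  "Harm k = {P. homogeneous_polynomial k P \<and> (\<forall>x. laplacian P x = 0)}"

definition Hst :: "'a::euclidean_space set \<Rightarrow> nat set" where
  "Hst X = {k. 1 \<le> k \<and> (\<forall>P\<in>Harm k. (\<Sum>\<xi>\<in>X. P \<xi>) = 0)}"

end

theory Submission
  imports Defs
begin

text \<open>
  In the plane \<open>Harm k\<close> consists of the functions \<open>Re (w * z ^ k)\<close>, so the harmonic strength is
  the set of vanishing power sums. If all products \<open>b * x\<close> with \<open>b \<in> B\<close>, \<open>x \<in> X\<close> are distinct, the power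
  sums of the product set are the products of the power sums, and so its strength is the union of the
  strengths of \<open>B\<close> and \<open>X\<close>. It therefore suffices to realise each singleton \<open>{t}\<close> by sets in which
  the ratios of distinct points avoid a given finite set.

  For \<open>t = 1\<close> take the pentagon \<open>1, u, cnj u, v, cnj v\<close> with \<open>2 * Re u = a\<close> and \<open>2 * Re v = - 1 - a\<close>.
  Its power sums are polynomials in \<open>a\<close> that for \<open>m \<ge> 2\<close> do not vanish at \<open>a = - 1 / 2\<close>, by a 2-adic
  argument; so a generic \<open>a\<close> works. For general \<open>t\<close>, take a set \<open>A\<close> of \<open>t\<close>-th roots of such a pentagon, one
  for each point; let \<open>A'\<close> arise from \<open>A\<close> by multiplying one point with a primitive \<open>t\<close>-th root of unity, and
  unite \<open>A\<close> with a generic rotation of \<open>A'\<close>, which intersects the strengths of \<open>A\<close> and \<open>A'\<close>.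
\<close>

section \<open>Harmonic polynomials in the plane\<close>

text \<open>In the plane a multi-index of weight \<open>k\<close> is fixed by its exponent
  \<open>j\<close> at the basis vector \<open>1\<close>, so the sum over multi-indices becomes a sum
  over \<open>j\<close>.\<close>

lemma sum_multi_indices_complex:
  fixes h :: "(complex \<Rightarrow> nat) \<Rightarrow> real"
  shows "(\<Sum>\<alpha> | \<alpha> \<in> (Basis::complex set) \<rightarrow>\<^sub>E {..k} \<and> sum \<alpha> Basis = k. h \<alpha>)
    = (\<Sum>j\<le>k. h (\<lambda>b\<in>Basis. if b = 1 then j else k - j))"
proof (rule sum.reindex_bij_witness[where i = "\<lambda>j. \<lambda>b\<in>Basis. if b = 1 then j else k - j"
      and j = "\<lambda>\<alpha>. \<alpha> 1"])
  fix \<alpha> :: "complex \<Rightarrow> nat"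
  assume "\<alpha> \<in> {\<alpha>. \<alpha> \<in> Basis \<rightarrow>\<^sub>E {..k} \<and> sum \<alpha> Basis = k}"
  then have ext: "\<alpha> \<in> extensional Basis" and s: "\<alpha> 1 + \<alpha> \<i> = k"
    by (auto simp: PiE_def Basis_complex_def)
  show *: "(\<lambda>b\<in>Basis. if b = 1 then \<alpha> 1 else k - \<alpha> 1) = \<alpha>"
    using ext s by (auto simp: fun_eq_iff restrict_def extensional_def Basis_complex_def)
  show "\<alpha> 1 \<in> {..k}" using s by auto
  show "h (\<lambda>b\<in>Basis. if b = 1 then \<alpha> 1 else k - \<alpha> 1) = h \<alpha>"
    using * by simp
next
  fix j assume "j \<in> {..k}"
  then show "(\<lambda>b\<in>Basis. if b = (1::complex) then j else k - j) 1 = j"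
    and "(\<lambda>b\<in>Basis. if b = 1 then j else k - j)
      \<in> {\<alpha>. \<alpha> \<in> (Basis::complex set) \<rightarrow>\<^sub>E {..k} \<and> sum \<alpha> Basis = k}"
    by (auto simp: Basis_complex_def)
qed

lemma homogeneous_polynomial_complex_iff:
  fixes P :: "complex \<Rightarrow> real"
  shows "homogeneous_polynomial k P \<longleftrightarrow>
    (\<exists>c. \<forall>z. P z = (\<Sum>j\<le>k. c j * (Re z ^ j * Im z ^ (k - j))))"
proof
  assume "homogeneous_polynomial k P"
  then obtain c where "\<forall>z. P z = (\<Sum>j\<le>k. c (\<lambda>b\<in>(Basis::complex set). if b = 1 then j else k - j)
      * (\<Prod>b\<in>Basis. (z \<bullet> b) ^ (\<lambda>b\<in>Basis. if b = 1 then j else k - j) b))"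
    unfolding homogeneous_polynomial_def sum_multi_indices_complex ..
  then show "\<exists>c. \<forall>z. P z = (\<Sum>j\<le>k. c j * (Re z ^ j * Im z ^ (k - j)))"
    by (intro exI[of _ "\<lambda>j. c (\<lambda>b\<in>Basis. if b = 1 then j else k - j)"])
      (simp add: Basis_complex_def)
next
  assume "\<exists>c. \<forall>z. P z = (\<Sum>j\<le>k. c j * (Re z ^ j * Im z ^ (k - j)))"
  then obtain c where "\<And>z. P z = (\<Sum>j\<le>k. c j * (Re z ^ j * Im z ^ (k - j)))" by blast
  then show "homogeneous_polynomial k P"
    unfolding homogeneous_polynomial_def sum_multi_indices_complex
    by (intro exI[of _ "\<lambda>\<alpha>. c (\<alpha> 1)"]) (simp add: Basis_complex_def)
qed

text \<open>The free exponents \<open>n j\<close> let one formula serve both coordinate directions.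
  Truncated subtraction is harmless: for \<open>n j < 2\<close> the coefficient is zero.\<close>

lemma deriv2_power_shift:
  fixes x :: real
  shows "(deriv ^^ 2) (\<lambda>t. \<Sum>j\<in>J. c j * (x + t) ^ n j) 0
    = (\<Sum>j\<in>J. c j * (real (n j) * real (n j - 1) * x ^ (n j - 2)))"
proof -
  have 1: "deriv (\<lambda>t. \<Sum>j\<in>J. c j * (x + t) ^ n j)
      = (\<lambda>t. \<Sum>j\<in>J. c j * (real (n j) * (x + t) ^ (n j - 1)))"
    by (rule ext, rule DERIV_imp_deriv) (auto intro!: derivative_eq_intros sum.cong)
  have 2: "deriv (\<lambda>t. \<Sum>j\<in>J. c j * (real (n j) * (x + t) ^ (n j - 1)))
      = (\<lambda>t. \<Sum>j\<in>J. c j * (real (n j) * real (n j - 1) * (x + t) ^ (n j - 2)))"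
    by (rule ext, rule DERIV_imp_deriv)
      (auto intro!: derivative_eq_intros sum.cong simp: numeral_2_eq_2)
  have "(deriv ^^ 2) f = deriv (deriv f)" for f :: "real \<Rightarrow> real"
    by (simp add: numeral_2_eq_2)
  then show ?thesis by (simp only: 1 2) simp
qed

lemma laplacian_complex_polynomial:
  fixes c :: "nat \<Rightarrow> real"
  shows "laplacian (\<lambda>z. \<Sum>j\<le>k. c j * (Re z ^ j * Im z ^ (k - j))) z
    = (\<Sum>j\<le>k. c j * (real j * real (j - 1) * Re z ^ (j - 2) * Im z ^ (k - j)
        + real (k - j) * real (k - j - 1) * Re z ^ j * Im z ^ (k - j - 2)))"
proof -
  have 1: "(deriv ^^ 2) (\<lambda>t. \<Sum>j\<le>k. c j * ((Re z + t) ^ j * Im z ^ (k - j))) 0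
     = (\<Sum>j\<le>k. c j * (real j * real (j - 1) * Re z ^ (j - 2) * Im z ^ (k - j)))"
    using deriv2_power_shift[of "\<lambda>j. c j * Im z ^ (k - j)" "Re z" "\<lambda>j. j" "{..k}"]
    by (simp add: mult_ac)
  have 2: "(deriv ^^ 2) (\<lambda>t. \<Sum>j\<le>k. c j * (Re z ^ j * (Im z + t) ^ (k - j))) 0
     = (\<Sum>j\<le>k. c j * (real (k - j) * real (k - j - 1) * Re z ^ j * Im z ^ (k - j - 2)))"
    using deriv2_power_shift[of "\<lambda>j. c j * Re z ^ j" "Im z" "\<lambda>j. k - j" "{..k}"]
    by (simp add: mult_ac)
  show ?thesis
    by (simp add: laplacian_def Basis_complex_def 1 2 distrib_left sum.distrib)
qed

section \<open>Harmonic forms in the plane as real parts of complex powers\<close>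

lemma Re_of_real_mult: "Re (of_real r * z) = r * Re z"
  by simp

lemma sum_shift_two:
  fixes f :: "nat \<Rightarrow> 'a::comm_monoid_add"
  assumes "f 0 = 0" "f 1 = 0"
  shows "(\<Sum>j\<le>Suc (Suc n). f j) = (\<Sum>j\<le>n. f (Suc (Suc j)))"
  using assms by (simp add: sum.atMost_Suc_shift del: sum.atMost_Suc)

text \<open>On the line \<open>Im z = 1\<close> the Laplacian is a polynomial in
  \<open>x = Re z\<close> that vanishes identically; the recurrence says that its coefficient at
  \<open>x ^ j\<close> is zero.\<close>

lemma harmonic_coefficient_recurrence:
  fixes c :: "nat \<Rightarrow> real"
  assumes lap: "\<And>z. laplacian (\<lambda>z. \<Sum>j\<le>k. c j * (Re z ^ j * Im z ^ (k - j))) z = 0"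
    and k: "k = Suc (Suc n)" and j: "j \<le> n"
  shows "c (Suc (Suc j)) * (real (Suc (Suc j)) * real (Suc j))
    = - (c j * (real (k - j) * real (k - j - 1)))"
proof -
  define d where "d j = c (Suc (Suc j)) * (real (Suc (Suc j)) * real (Suc j))
    + c j * (real (k - j) * real (k - j - 1))" for j
  have "(\<Sum>j\<le>n. d j * x ^ j) = 0" for x
  proof -
    have "0 = (\<Sum>j\<le>k. c j * (real j * real (j - 1)) * x ^ (j - 2))
        + (\<Sum>j\<le>k. c j * (real (k - j) * real (k - j - 1)) * x ^ j)"
      using lap[of "Complex x 1"]
      by (simp add: laplacian_complex_polynomial distrib_left sum.distrib mult_ac)
    also have "(\<Sum>j\<le>k. c j * (real j * real (j - 1)) * x ^ (j - 2))
      = (\<Sum>j\<le>n. c (Suc (Suc j)) * (real (Suc (Suc j)) * real (Suc j)) * x ^ j)"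
      unfolding k by (subst sum_shift_two) auto
    also have "(\<Sum>j\<le>k. c j * (real (k - j) * real (k - j - 1)) * x ^ j)
      = (\<Sum>j\<le>n. c j * (real (k - j) * real (k - j - 1)) * x ^ j)"
      unfolding k by simp
    finally show ?thesis
      by (simp add: d_def distrib_right sum.distrib)
  qed
  then have "d j = 0" using polyfun_eq_0[of d n] j by blast
  then show ?thesis by (simp add: d_def)
qed

text \<open>The recurrence determines all coefficients from \<open>c 0\<close> and
  \<open>c 1\<close>, and a suitable multiple of \<open>z ^ k\<close> already matches these
  two.\<close>

lemma Harm_complex_eq_Re_power:
  assumes "P \<in> Harm k" "k \<ge> 1"
  obtains w where "\<And>z. P z = Re (w * z ^ k)"
proof -
  obtain c where P: "P = (\<lambda>z. \<Sum>j\<le>k. c j * (Re z ^ j * Im z ^ (k - j)))"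
    using assms unfolding Harm_def homogeneous_polynomial_complex_iff by auto
  \<comment> \<open>Expanding \<open>Re (\<delta> * (- \<i> * z) ^ k)\<close> gives
    \<open>Re \<delta>\<close> as coefficient for \<open>j = 0\<close> and
    \<open>k * Im \<delta>\<close> for \<open>j = 1\<close>.\<close>
  define \<delta> where "\<delta> = Complex (c 0) (c 1 / k)"
  have lap: "laplacian (\<lambda>z. \<Sum>j\<le>k. c j * (Re z ^ j * Im z ^ (k - j))) z = 0" for z
    using assms unfolding Harm_def P by simp
  have c: "c j = real (k choose j) * Re (\<delta> * (-\<i>) ^ j)" if "j \<le> k" for j
    using that
  proof (induction j rule: induct_nat_012)
    case 0
    show ?case by (simp add: \<delta>_def)
  next
    case 1
    then show ?case by (simp add: \<delta>_def)
  next
    case (ge2 j)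
    define n where "n = k - 2"
    have n: "k = Suc (Suc n)" "j \<le> n" using ge2.prems by (auto simp: n_def)
    let ?q = "real (Suc (Suc j)) * real (Suc j)"
    have "c (Suc (Suc j)) * ?q = - (c j * (real (k - j) * real (k - j - 1)))"
      by (rule harmonic_coefficient_recurrence[OF lap n])
    also have "\<dots> = - (real ((k choose j) * (k - j) * (k - j - 1)) * Re (\<delta> * (-\<i>) ^ j))"
      using ge2 by simp
    \<comment> \<open>The absorption identity for binomial coefficients, applied at \<open>j\<close>
      and at \<open>Suc j\<close>. The remaining minus sign is the square of
      \<open>-\<i>\<close>.\<close>
    also have "(k choose j) * (k - j) * (k - j - 1) = (k choose Suc (Suc j)) * (Suc (Suc j) * Suc j)"
    proof -
      have "(k choose j) * (k - j) = (k choose Suc j) * Suc j"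
        by (metis binomial_absorb_comp binomial_absorption mult.commute n(1) diff_Suc_1)
      moreover have "(k choose Suc j) * (k - Suc j) = (k choose Suc (Suc j)) * Suc (Suc j)"
        by (metis binomial_absorb_comp binomial_absorption mult.commute n(1) diff_Suc_1)
      moreover have "(k choose j) * (k - j) * (k - j - 1) = (k choose j) * (k - j) * (k - Suc j)"
        by simp
      ultimately show ?thesis by (simp only: mult_ac)
    qed
    also have "- (real ((k choose Suc (Suc j)) * (Suc (Suc j) * Suc j)) * Re (\<delta> * (-\<i>) ^ j))
      = real (k choose Suc (Suc j)) * Re (\<delta> * (-\<i>) ^ Suc (Suc j)) * ?q"
      by (simp add: algebra_simps)
    finally show ?case by simp
  qed
  have "P z = Re (\<delta> * (-\<i>) ^ k * z ^ k)" for z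
  proof -
    have "- \<i> * z = - \<i> * of_real (Re z) + of_real (Im z)"
      by (simp add: complex_eq_iff)
    then have "\<delta> * (- \<i> * z) ^ k = (\<Sum>j\<le>k. \<delta> * (of_nat (k choose j) * (- \<i> * of_real (Re z)) ^ j
        * of_real (Im z) ^ (k - j)))"
      by (simp only: binomial_ring sum_distrib_left)
    also have "\<dots> = (\<Sum>j\<le>k. of_real (real (k choose j) * (Re z ^ j * Im z ^ (k - j)))
        * (\<delta> * (-\<i>) ^ j))"
      by (intro sum.cong refl) (simp only: power_mult_distrib of_real_mult of_real_power
          of_real_of_nat_eq mult_ac)
    finally have "Re (\<delta> * (- \<i> * z) ^ k)
      = (\<Sum>j\<le>k. (real (k choose j) * (Re z ^ j * Im z ^ (k - j))) * Re (\<delta> * (-\<i>) ^ j))"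
      by (simp only: Re_sum Re_of_real_mult)
    also have "\<dots> = P z"
      unfolding P by (intro sum.cong refl) (simp only: c atMost_iff mult_ac)
    finally show ?thesis by (simp only: power_mult_distrib mult_ac)
  qed
  then show ?thesis by (rule that)
qed

text \<open>Homogeneity is the binomial expansion. The second derivative along \<open>b\<close>
  carries the factor \<open>b * b\<close>, and these factors cancel for \<open>b = 1\<close> and
  \<open>b = \<i>\<close>.\<close>

lemma Re_power_in_Harm:
  "(\<lambda>z. Re (w * z ^ k)) \<in> Harm k"
proof -
  have "homogeneous_polynomial k (\<lambda>z. Re (w * z ^ k))"
  proof -
    have "Re (w * z ^ k) = (\<Sum>j\<le>k. (real (k choose j) * Re (w * \<i> ^ (k - j)))
        * (Re z ^ j * Im z ^ (k - j)))" for z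
    proof -
      have "z ^ k = (of_real (Re z) + \<i> * of_real (Im z)) ^ k"
        by (simp flip: complex_eq)
      then have "w * z ^ k = (\<Sum>j\<le>k. w * (of_nat (k choose j) * of_real (Re z) ^ j
          * (\<i> * of_real (Im z)) ^ (k - j)))"
        by (simp only: binomial_ring sum_distrib_left)
      also have "\<dots> = (\<Sum>j\<le>k. of_real (real (k choose j) * (Re z ^ j * Im z ^ (k - j)))
          * (w * \<i> ^ (k - j)))"
        by (intro sum.cong refl) (simp only: power_mult_distrib of_real_mult of_real_power
            of_real_of_nat_eq mult_ac)
      finally have "Re (w * z ^ k) = (\<Sum>j\<le>k. (real (k choose j) * (Re z ^ j * Im z ^ (k - j)))
          * Re (w * \<i> ^ (k - j)))"
        by (simp only: Re_sum Re_of_real_mult)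
      then show ?thesis by (simp only: mult_ac)
    qed
    then show ?thesis
      unfolding homogeneous_polynomial_complex_iff by (intro exI allI)
  qed
  moreover have "laplacian (\<lambda>z. Re (w * z ^ k)) z = 0" for z
  proof -
    \<comment> \<open>With \<open>w'\<close> and \<open>n\<close> free the formula applies twice:
      differentiating replaces \<open>w'\<close> by \<open>of_nat n * b * w'\<close> and
      \<open>n\<close> by \<open>n - 1\<close>.\<close>
    have 1: "deriv (\<lambda>t. Re (w' * (z + t *\<^sub>R b) ^ n)) = (\<lambda>t. Re (of_nat n * b * w' * (z + t *\<^sub>R b) ^ (n - 1)))"
      for b w' n
    proof (rule ext, rule DERIV_imp_deriv)
      fix t
      have "((\<lambda>x. w' * (z + x * b) ^ n) has_field_derivative (of_nat n * b * w' * (z + of_real t * b) ^ (n - 1)))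
          (at (of_real t))"
        by (auto intro!: derivative_eq_intros)
      then have "((\<lambda>x. w' * (z + of_real x * b) ^ n) has_vector_derivative
          (of_nat n * b * w' * (z + of_real t * b) ^ (n - 1))) (at t)"
        by (rule has_vector_derivative_real_field)
      then show "((\<lambda>t. Re (w' * (z + t *\<^sub>R b) ^ n)) has_real_derivative
          Re (of_nat n * b * w' * (z + t *\<^sub>R b) ^ (n - 1))) (at t)"
        unfolding scaleR_conv_of_real has_real_derivative_iff_has_vector_derivative
        by (rule bounded_linear.has_vector_derivative[OF bounded_linear_Re])
    qed
    have "(deriv ^^ 2) (\<lambda>t. Re (w * (z + t *\<^sub>R b) ^ k)) 0
      = Re (of_nat (k - 1) * b * (of_nat k * b * w) * z ^ (k - 1 - 1))" for b
      by (simp only: numeral_2_eq_2 funpow.simps o_apply id_apply 1) simp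
    then show ?thesis
      unfolding laplacian_def by (simp only:) (simp add: Basis_complex_def algebra_simps)
  qed
  ultimately show ?thesis by (simp add: Harm_def)
qed

lemma Hst_complex:
  fixes X :: "complex set"
  shows "Hst X = {k. 1 \<le> k \<and> (\<Sum>x\<in>X. x ^ k) = 0}"
proof -
  have "(\<forall>P\<in>Harm k. (\<Sum>\<xi>\<in>X. P \<xi>) = 0) \<longleftrightarrow> (\<Sum>x\<in>X. x ^ k) = 0" if k: "1 \<le> k" for k
  proof
    assume "\<forall>P\<in>Harm k. (\<Sum>\<xi>\<in>X. P \<xi>) = 0"
    then have *: "(\<Sum>\<xi>\<in>X. Re (w * \<xi> ^ k)) = 0" for w
      using Re_power_in_Harm by blast
    show "(\<Sum>x\<in>X. x ^ k) = 0"
      \<comment> \<open>\<open>w = 1\<close> extracts the real part of the power sum and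
        \<open>w = -\<i>\<close> the imaginary part.\<close>
      using *[of 1] *[of "-\<i>"] by (simp add: complex_eq_iff)
  next
    assume s: "(\<Sum>x\<in>X. x ^ k) = 0"
    show "\<forall>P\<in>Harm k. (\<Sum>\<xi>\<in>X. P \<xi>) = 0"
    proof
      fix P :: "complex \<Rightarrow> real" assume "P \<in> Harm k"
      then obtain w where "\<And>z. P z = Re (w * z ^ k)"
        using Harm_complex_eq_Re_power[OF _ k] by blast
      then have "(\<Sum>\<xi>\<in>X. P \<xi>) = Re (w * (\<Sum>x\<in>X. x ^ k))"
        by (simp only: sum_distrib_left Re_sum)
      then show "(\<Sum>\<xi>\<in>X. P \<xi>) = 0" using s by simp
    qed
  qed
  then show ?thesis unfolding Hst_def by blast
qed

section \<open>Pentagons of unit vectors\<close>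

text \<open>Chebyshev polynomials \<open>T\<close> of the first kind, rescaled to
  \<open>2 * T n (x / 2)\<close>; this form has integer coefficients and is monic for
  \<open>n \<ge> 1\<close>.\<close>

fun dickson :: "nat \<Rightarrow> real poly" where
  "dickson 0 = [:2:]"
| "dickson (Suc 0) = [:0, 1:]"
| "dickson (Suc (Suc n)) = [:0, 1:] * dickson (Suc n) - dickson n"

lemma poly_dickson_Re:
  assumes "norm u = 1"
  shows "poly (dickson n) (2 * Re u) = 2 * Re (u ^ n)"
proof (induction n rule: dickson.induct)
  case (3 n)
  have "u * cnj u = 1" using assms by (simp add: complex_norm_square[symmetric])
  then have "u ^ Suc (Suc n) + u ^ n = (u + cnj u) * u ^ Suc n"
    by (simp add: algebra_simps)
  then have "Re (u ^ Suc (Suc n)) + Re (u ^ n) = 2 * Re u * Re (u ^ Suc n)"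
    unfolding complex_add_cnj by (metis plus_complex.sel(1) Re_complex_of_real Im_complex_of_real
        times_complex.sel(1) mult_zero_left diff_zero)
  then show ?case using 3 by (simp del: power_Suc add: algebra_simps)
qed auto

text \<open>The scaled values satisfy \<open>N (n + 2) = - N (n + 1) - 4 * N n\<close> with
  \<open>N 0 = 2\<close> and \<open>N 1 = - 1\<close>, so oddness propagates from index 1
  on.\<close>

lemma poly_dickson_minus_half:
  assumes "n \<ge> 1"
  shows "\<exists>N::int. odd N \<and> poly (dickson n) (- 1 / 2) * 2 ^ n = of_int N"
proof -
  have "\<exists>N M::int. odd M \<and> poly (dickson n) (- 1 / 2) * 2 ^ n = of_int N
      \<and> poly (dickson (Suc n)) (- 1 / 2) * 2 ^ Suc n = of_int M" for n
  proof (induction n)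
    case 0
    show ?case by (intro exI[of _ 2] exI[of _ "- 1"]) simp
  next
    case (Suc n)
    then obtain N M :: int where *: "odd M" "poly (dickson n) (- 1 / 2) * 2 ^ n = of_int N"
      "poly (dickson (Suc n)) (- 1 / 2) * 2 ^ Suc n = of_int M" by blast
    have "poly (dickson (Suc (Suc n))) (- 1 / 2) * 2 ^ Suc (Suc n)
      = - (poly (dickson (Suc n)) (- 1 / 2) * 2 ^ Suc n) - 4 * (poly (dickson n) (- 1 / 2) * 2 ^ n)"
      by (simp add: algebra_simps)
    also have "\<dots> = of_int (- M - 4 * N)" unfolding * by simp
    finally show ?case using * by (intro exI[of _ M] exI[of _ "- M - 4 * N"]) auto
  qed
  then show ?thesis using assms by (cases n) auto
qed

text \<open>The power sum of order \<open>m\<close> of the pentagon as a polynomial in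
  \<open>a = 2 * Re u\<close>; the composition substitutes
  \<open>- 1 - a = 2 * Re v\<close>.\<close>

definition pentagon_poly :: "nat \<Rightarrow> real poly" where
  "pentagon_poly m = 1 + dickson m + dickson m \<circ>\<^sub>p [:- 1, - 1:]"

text \<open>At the fixed point \<open>- 1 / 2\<close> of \<open>a \<mapsto> - 1 - a\<close> both
  Dickson terms agree. A zero there would make the odd integer \<open>N\<close> equal to
  \<open>- (2 ^ (m - 1))\<close>, which is even for \<open>m \<ge> 2\<close>.\<close>

lemma pentagon_poly_nonzero:
  assumes "m \<ge> 2"
  shows "pentagon_poly m \<noteq> 0"
proof
  assume "pentagon_poly m = 0"
  then have "poly (pentagon_poly m) (- 1 / 2) = 0" by simp
  then have p: "1 + 2 * poly (dickson m) (- 1 / 2) = 0"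
    by (simp add: pentagon_poly_def poly_pcompose)
  obtain N :: int where N: "odd N" "poly (dickson m) (- 1 / 2) * 2 ^ m = of_int N"
    using poly_dickson_minus_half[of m] assms by auto
  obtain n where n: "m = Suc (Suc n)"
    using assms by (metis One_nat_def Suc_1 Suc_le_D add_2_eq_Suc le_Suc_ex)
  have "poly (dickson m) (- 1 / 2) = - 1 / 2" using p by simp
  then have "real_of_int (- (2 * 2 ^ n)) = of_int N" using N(2) by (simp add: n)
  then have "N = - (2 * 2 ^ n)" by (simp only: of_int_eq_iff)
  then show False using N(1) by simp
qed

text \<open>Since \<open>p * cnj p = 1\<close>, the assumption says \<open>r = p * p\<close>; hence
  \<open>r\<close> determines \<open>Re p\<close> up to sign.\<close>

lemma unit_ratio_conjugate:
  assumes "norm p = 1" "p = r * cnj p"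
  shows "(2 * Re p)\<^sup>2 - 2 = 2 * Re r"
proof -
  have "p * p = r * (p * cnj p)" using assms(2) by (metis mult.assoc mult.commute)
  also have "p * cnj p = 1" using assms(1) by (simp add: complex_norm_square[symmetric])
  finally have "r = p * p" by simp
  then have "Re r = (Re p)\<^sup>2 - (Im p)\<^sup>2" by (simp add: power2_eq_square)
  moreover have "(Re p)\<^sup>2 + (Im p)\<^sup>2 = 1" using assms(1) by (simp add: cmod_def)
  ultimately show ?thesis by (simp add: power_mult_distrib)
qed

text \<open>Multiply \<open>1 + p + cnj p + q + cnj q = 0\<close> by \<open>q\<close>. The middle
  coefficient 1 keeps the quadratic nonzero even for \<open>r = - 1\<close>, so each
  \<open>r\<close> allows only finitely many \<open>q\<close>.\<close>

lemma unit_ratio_quadratic: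
  assumes "norm p = 1" "norm q = 1" "1 + 2 * Re p + 2 * Re q = 0" "p = r * q"
  shows "poly [:1 + cnj r, 1, 1 + r:] q = 0"
proof -
  have q: "cnj q * q = 1" using assms(2) by (simp add: complex_norm_square[symmetric] mult.commute)
  have "of_real (1 + 2 * Re p + 2 * Re q) = 1 + (p + cnj p) + (q + cnj q)"
    by (simp add: complex_add_cnj)
  then have "1 + (p + cnj p) + (q + cnj q) = 0" using assms(3) by simp
  then have "(1 + (r * q + cnj r * cnj q) + (q + cnj q)) * q = 0" using assms(4) by simp
  then have "q + (r * q * q + cnj r * (cnj q * q)) + (q * q + cnj q * q) = 0"
    by (simp add: algebra_simps)
  then show ?thesis unfolding q by (simp add: algebra_simps)
qed

lemma unit_complex_with_Re:
  fixes a :: real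
  assumes "\<bar>a\<bar> \<le> 2"
  obtains u where "norm u = 1" "2 * Re u = a"
proof -
  have "(a / 2)\<^sup>2 \<le> 1" using assms by (simp add: abs_square_le_1)
  then have "norm (Complex (a / 2) (sqrt (1 - (a / 2)\<^sup>2))) = 1" by (simp add: cmod_def)
  then show ?thesis by (rule that) simp
qed

lemma finite_real_square_eq: "finite {x::real. x\<^sup>2 = s}"
proof -
  have "{x::real. x\<^sup>2 = s} \<subseteq> {sqrt s, - sqrt s}"
    by (auto simp: real_sqrt_unique)
  then show ?thesis by (rule finite_subset) simp
qed

lemma generic_pentagon:
  fixes R :: "complex set"
  assumes "finite R"
  shows "\<exists>Y. finite Y \<and> Y \<noteq> {} \<and> Y \<subseteq> sphere 0 1
    \<and> (\<forall>m\<ge>1. (\<Sum>y\<in>Y. y ^ m) = 0 \<longleftrightarrow> m = 1)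
    \<and> (\<forall>y\<in>Y. \<forall>y'\<in>Y. \<forall>r\<in>R. y = r * y' \<longrightarrow> y = y')"
proof -
  define W where "W r = {w. poly [:1 + cnj r, 1, 1 + r:] w = 0}" for r :: complex
  \<comment> \<open>\<open>F r\<close> collects the values \<open>2 * Re p\<close> of the unit vectors \<open>p\<close> that can have ratio \<open>r\<close> or \<open>1 / r\<close>
    to \<open>1\<close>, ratio \<open>r\<close> to \<open>cnj p\<close>, or be the denominator of a ratio \<open>r\<close> between the two conjugate pairs.\<close>
  define F where "F r = {2 * Re r, 2 * Re (1 / r)} \<union> {a. a\<^sup>2 = 2 + 2 * Re r} \<union> (\<lambda>w. 2 * Re w) ` W r"
    for r :: complex
  \<comment> \<open>Two coinciding points have ratio 1, so including \<open>1\<close> also makes the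
    five points distinct.\<close>
  define B where "B = (\<Union>r\<in>insert 1 R. F r)"
  define C where "C = (\<Union>m\<in>{2..}. {a. poly (pentagon_poly m) a = 0})"
  have "finite (W r)" for r
    unfolding W_def by (rule poly_roots_finite) simp
  then have "finite (F r)" for r
    using finite_real_square_eq unfolding F_def by simp
  then have B: "finite B" using assms by (simp add: B_def)
  have C: "countable C"
    unfolding C_def by (intro countable_UN) (auto intro!: countable_finite poly_roots_finite
        simp: pentagon_poly_nonzero)
  \<comment> \<open>For \<open>a\<close> in this interval both \<open>a\<close> and
    \<open>- 1 - a\<close> have modulus at most 2, so \<open>u\<close> and \<open>v\<close> exist.
    Removing the reflected copy of \<open>B\<close> keeps \<open>2 * Re v\<close> outside
    \<open>B\<close> as well.\<close>
  have "uncountable ({- 1 <..< 0} - (B \<union> (\<lambda>b. - 1 - b) ` B \<union> C))"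
    using B C by (intro uncountable_minus_countable) (auto simp: uncountable_open_interval countable_finite)
  then have "{- 1 <..< 0} - (B \<union> (\<lambda>b. - 1 - b) ` B \<union> C) \<noteq> {}" by (metis countable_empty)
  then obtain a where "a \<in> {- 1 <..< 0} - (B \<union> (\<lambda>b. - 1 - b) ` B \<union> C)" by blast
  then have a: "- 1 < a" "a < 0" "a \<notin> B" "a \<notin> (\<lambda>b. - 1 - b) ` B" "a \<notin> C"
    unfolding Diff_iff Un_iff greaterThanLessThan_iff by blast+
  have "- 1 - a \<notin> B"
  proof
    assume "- 1 - a \<in> B"
    from imageI[OF this, of "\<lambda>b. - 1 - b"] a(4) show False by simp
  qed
  note a = a(1-3) this a(5)
  obtain u where u: "norm u = 1" "2 * Re u = a" using unit_complex_with_Re[of a] a by auto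
  obtain v where v: "norm v = 1" "2 * Re v = - 1 - a" using unit_complex_with_Re[of "- 1 - a"] a by auto
  define Y where "Y = {1, u, cnj u, v, cnj v}"
  have F: "2 * Re p \<notin> F r" if "r \<in> insert 1 R" "p \<in> {u, cnj u, v, cnj v}" for r p
    using that a u v unfolding B_def by auto
  have n1: "p \<noteq> r" "1 \<noteq> r * p" if "r \<in> insert 1 R" "p \<in> {u, cnj u, v, cnj v}" for r p
  proof -
    show "p \<noteq> r" using F[OF that] by (auto simp: F_def)
    show "1 \<noteq> r * p"
    proof
      assume *: "1 = r * p"
      then have "p = 1 / r" by (metis mult_zero_left nonzero_mult_div_cancel_left zero_neq_one)
      then show False using F[OF that] by (auto simp: F_def)
    qed
  qed
  have n2: "p \<noteq> r * cnj p" if "r \<in> insert 1 R" "p \<in> {u, cnj u, v, cnj v}" for r p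
  proof
    assume "p = r * cnj p"
    moreover have "norm p = 1" using that u v by auto
    ultimately have "(2 * Re p)\<^sup>2 - 2 = 2 * Re r" by (intro unit_ratio_conjugate)
    then show False using F[OF that] by (auto simp: F_def)
  qed
  have n3: "p \<noteq> r * q" if "r \<in> insert 1 R" "p \<in> {u, cnj u} \<and> q \<in> {v, cnj v} \<or> p \<in> {v, cnj v} \<and> q \<in> {u, cnj u}" for r p q
  proof
    assume "p = r * q"
    moreover have "norm p = 1" "norm q = 1" "1 + 2 * Re p + 2 * Re q = 0" using that u v by auto
    ultimately have "q \<in> W r" unfolding W_def using unit_ratio_quadratic by blast
    moreover have "q \<in> {u, cnj u, v, cnj v}" using that by auto
    ultimately show False using F[OF that(1), of q] by (auto simp: F_def)
  qed
  have Y: "y = y'" if yY: "y \<in> Y" "y' \<in> Y" and r: "r \<in> insert 1 R" and eq: "y = r * y'" for y y' r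
  proof (rule ccontr)
    assume ne: "y \<noteq> y'"
    consider (one_left) "y = 1" "y' \<in> {u, cnj u, v, cnj v}"
      | (one_right) "y' = 1" "y \<in> {u, cnj u, v, cnj v}"
      | (conj) "y' = cnj y" "y \<in> {u, cnj u, v, cnj v}"
      | (mixed) "y \<in> {u, cnj u} \<and> y' \<in> {v, cnj v} \<or> y \<in> {v, cnj v} \<and> y' \<in> {u, cnj u}"
      using yY ne unfolding Y_def by (elim insertE emptyE) simp_all
    then show False
    proof cases
      case one_left
      then show False using n1(2)[OF r one_left(2)] eq by simp
    next
      case one_right
      then show False using n1(1)[OF r one_right(2)] eq by simp
    next
      case conj
      show False using n2[OF r conj(2)] eq[unfolded conj(1)] by contradiction
    next
      case mixed
      show False using n3[OF r mixed] eq by contradiction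
    qed
  qed
  have distinct: "1 \<notin> {u, cnj u, v, cnj v}" "u \<notin> {cnj u, v, cnj v}" "cnj u \<notin> {v, cnj v}" "v \<noteq> cnj v"
  proof -
    show "1 \<notin> {u, cnj u, v, cnj v}" using n1(1)[of 1 1] by blast
    show "u \<notin> {cnj u, v, cnj v}" using n2[of 1 u] n3[of 1 u v] n3[of 1 u "cnj v"] by simp
    show "cnj u \<notin> {v, cnj v}" using n3[of 1 "cnj u" v] n3[of 1 u v] by simp
    show "v \<noteq> cnj v" using n2[of 1 v] by simp
  qed
  have sum: "(\<Sum>y\<in>Y. y ^ m) = of_real (poly (pentagon_poly m) a)" for m
  proof -
    have "(\<Sum>y\<in>Y. y ^ m) = 1 + (u ^ m + cnj (u ^ m)) + (v ^ m + cnj (v ^ m))"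
      unfolding Y_def using distinct by (simp add: add_ac)
    also have "\<dots> = of_real (1 + poly (dickson m) (2 * Re u) + poly (dickson m) (2 * Re v))"
      by (simp only: complex_add_cnj poly_dickson_Re[OF u(1)] poly_dickson_Re[OF v(1)]
          of_real_add of_real_1)
    also have "1 + poly (dickson m) (2 * Re u) + poly (dickson m) (2 * Re v) = poly (pentagon_poly m) a"
      unfolding u v by (simp add: pentagon_poly_def poly_pcompose)
    finally show ?thesis .
  qed
  show ?thesis
  proof (intro exI conjI ballI allI impI)
    show "finite Y" "Y \<noteq> {}" "Y \<subseteq> sphere 0 1" using u v by (auto simp: Y_def)
    show "y = y'" if "y \<in> Y" "y' \<in> Y" "r \<in> R" "y = r * y'" for y y' r
      using Y that by blast
    show "(\<Sum>y\<in>Y. y ^ m) = 0 \<longleftrightarrow> m = 1" if "m \<ge> 1" for m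
    proof (cases "m = 1")
      case True
      then show ?thesis unfolding sum by (simp add: pentagon_poly_def poly_pcompose)
    next
      case False
      then have "m \<in> {2..}" using that by auto
      then have "poly (pentagon_poly m) a \<noteq> 0" using a(5) unfolding C_def by blast
      then show ?thesis unfolding sum using False by simp
    qed
  qed
qed

section \<open>Generic unions and products\<close>

lemma uncountable_unit_circle: "uncountable (sphere (0::complex) 1)"
  by (rule connected_uncountable[of _ 1 "- 1"]) (auto intro!: connected_sphere)

text \<open>If the power sum of \<open>A'\<close> of order \<open>k\<close> is nonzero, cancellation
  prescribes \<open>s ^ k\<close> and thus leaves finitely many \<open>s\<close>. Over all
  \<open>k\<close> this excludes countably many points of the uncountable circle.\<close>

lemma generic_rotation:
  fixes A A' C :: "complex set"
  assumes "finite C"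
  shows "\<exists>s. norm s = 1 \<and> s \<notin> C \<and>
    (\<forall>k\<ge>1. (\<Sum>x\<in>A. x ^ k) + s ^ k * (\<Sum>x\<in>A'. x ^ k) = 0
      \<longleftrightarrow> (\<Sum>x\<in>A. x ^ k) = 0 \<and> (\<Sum>x\<in>A'. x ^ k) = 0)"
proof -
  define p where "p k = (\<Sum>x\<in>A. x ^ k)" for k :: nat
  define q where "q k = (\<Sum>x\<in>A'. x ^ k)" for k :: nat
  define D where "D = (\<Union>k\<in>{k. k \<ge> 1 \<and> q k \<noteq> 0}. {s. s ^ k = - p k / q k})"
  have "finite {s. s ^ k = c}" if "k \<ge> 1" for k and c :: complex
    using finite_nth_roots[of k c] that by simp
  then have "countable D"
    unfolding D_def by (intro countable_UN) (auto intro!: countable_finite)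
  then have "uncountable (sphere (0::complex) 1 - (C \<union> D))"
    using assms uncountable_unit_circle by (intro uncountable_minus_countable) (auto intro: countable_finite)
  then have "sphere (0::complex) 1 - (C \<union> D) \<noteq> {}" by (metis countable_empty)
  then obtain s where "s \<in> sphere 0 1" and s: "s \<notin> C" "s \<notin> D" by blast
  then have s: "norm s = 1" "s \<notin> C" "s \<notin> D" by auto
  show ?thesis
  proof (intro exI conjI allI impI)
    show "norm s = 1" "s \<notin> C" using s by simp_all
  next
    fix k :: nat assume k: "k \<ge> 1"
    have "p k + s ^ k * q k \<noteq> 0" if "q k \<noteq> 0"
    proof
      assume "p k + s ^ k * q k = 0"
      then have "s ^ k = - p k / q k" using that by (simp add: field_simps add_eq_0_iff)
      then show False using s(3) that k by (auto simp: D_def)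
    qed
    then show "(\<Sum>x\<in>A. x ^ k) + s ^ k * (\<Sum>x\<in>A'. x ^ k) = 0
      \<longleftrightarrow> (\<Sum>x\<in>A. x ^ k) = 0 \<and> (\<Sum>x\<in>A'. x ^ k) = 0"
      unfolding p_def[symmetric] q_def[symmetric] by (cases "q k = 0") auto
  qed
qed

section \<open>Realising singletons by roots of a pentagon\<close>

lemma exists_nth_root:
  fixes y :: complex
  assumes "t \<ge> 1"
  shows "\<exists>x. x ^ t = y"
proof -
  have "{x. x ^ t = y} \<noteq> {}"
  proof (cases "y = 0")
    case True
    then show ?thesis using assms by (auto intro!: exI[of _ 0])
  next
    case False
    then have "card {x. x ^ t = y} = t" using assms by (intro card_nth_roots) auto
    then show ?thesis using assms by (metis card.empty not_one_le_zero)
  qed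
  then show ?thesis by blast
qed

text \<open>
  Two systems \<open>f\<close> and \<open>g\<close> of \<open>t\<close>-th roots of a pentagon that differ in a single point have
  different power sums of order \<open>k\<close> unless \<open>t\<close> divides \<open>k\<close>, so these cannot both vanish; and for
  \<open>k = t * m\<close> both equal the power sum of order \<open>m\<close> of the pentagon.
\<close>

lemma exists_singleton_strength:
  fixes R :: "complex set"
  assumes "finite R" and t: "t \<ge> 1"
  shows "\<exists>X. finite X \<and> X \<noteq> {} \<and> X \<subseteq> sphere 0 1
    \<and> (\<forall>k\<ge>1. (\<Sum>x\<in>X. x ^ k) = 0 \<longleftrightarrow> k = t)
    \<and> (\<forall>x\<in>X. \<forall>x'\<in>X. \<forall>r\<in>R. x = r * x' \<longrightarrow> x = x')"
proof -
  \<comment> \<open>A ratio \<open>r\<close> between \<open>t\<close>-th roots becomes the ratio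
    \<open>r ^ t\<close> between pentagon points, so the pentagon must avoid the powers
    \<open>r ^ t\<close>.\<close>
  obtain Y where Y: "finite Y" "Y \<noteq> {}" "Y \<subseteq> sphere 0 1"
    and sumY: "\<forall>m\<ge>1. (\<Sum>y\<in>Y. y ^ m) = 0 \<longleftrightarrow> m = 1"
    and ratioY: "\<forall>y\<in>Y. \<forall>y'\<in>Y. \<forall>r\<in>(\<lambda>r. r ^ t) ` R. y = r * y' \<longrightarrow> y = y'"
    using generic_pentagon[OF finite_imageI[OF assms(1), of "\<lambda>r. r ^ t"]] by (elim exE conjE) (rule that)
  define f where "f y = (SOME x. x ^ t = y)" for y :: complex
  have f: "f y ^ t = y" for y
    unfolding f_def using exists_nth_root[OF t] by (rule someI_ex)
  obtain y0 where y0: "y0 \<in> Y" using Y(2) by blast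
  define \<zeta> where "\<zeta> = exp (2 * of_real pi * \<i> * of_nat 1 / of_nat t)"
  have zeta_power: "\<zeta> ^ k = 1 \<longleftrightarrow> t dvd k" for k
    using complex_root_unity_eq_1[OF t, of k]
    by (simp add: \<zeta>_def exp_of_nat_mult[symmetric] mult_ac)
  \<comment> \<open>For \<open>t = 1\<close> this gives \<open>\<zeta> = 1\<close> and
    \<open>g = f\<close>, but then \<open>t\<close> divides every \<open>k\<close> and no difference
    between the two is required.\<close>
  define g where "g = f(y0 := \<zeta> * f y0)"
  have g: "g y ^ t = y" for y
    using zeta_power[of t] by (simp add: g_def f power_mult_distrib)
  have sum_root: "(\<Sum>x\<in>h ` Y. x ^ k) = (\<Sum>y\<in>Y. h y ^ k)" if "\<And>y. h y ^ t = y" for h k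
  proof -
    have "inj_on h Y" by (rule inj_on_inverseI[of _ "\<lambda>x. x ^ t"]) (rule that)
    then show ?thesis by (simp add: sum.reindex)
  qed
  have sum_root_dvd: "(\<Sum>y\<in>Y. h y ^ k) = (\<Sum>y\<in>Y. y ^ (k div t))" if "\<And>y. h y ^ t = y" "t dvd k" for h k
  proof (intro sum.cong refl)
    fix y
    have "h y ^ k = h y ^ (t * (k div t))" using that(2) by simp
    then show "h y ^ k = y ^ (k div t)" by (simp only: power_mult that(1))
  qed
  have unit: "norm (h y) = 1" if "\<And>y. h y ^ t = y" "y \<in> Y" for h y
  proof -
    have "norm (h y) ^ t = norm y" by (simp only: that(1) flip: norm_power)
    also have "norm y = 1" using that(2) Y(3) by auto
    finally have "norm (h y) ^ t = 1" .
    then show ?thesis using t power_eq_imp_eq_base[of "norm (h y)" t 1] by simp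
  qed
  have ratio: "h y = h y'" if "\<And>y. h y ^ t = y" "y \<in> Y" "y' \<in> Y" "r \<in> R" "h y = r * h y'" for h y y' r
  proof -
    have "h y ^ t = (r * h y') ^ t" by (simp only: that(5))
    then have "y = r ^ t * y'" by (simp only: power_mult_distrib that(1))
    then have "y = y'" using ratioY that(2,3) imageI[OF that(4), of "\<lambda>r. r ^ t"] by blast
    then show ?thesis by simp
  qed
  \<comment> \<open>The rotations that create a ratio from \<open>insert 1 R\<close> between the two
    halves, in either direction; excluding ratio 1 makes the halves disjoint.\<close>
  define C where "C = (\<lambda>(r, y, y'). r * f y / g y') ` (insert 1 R \<times> Y \<times> Y)
    \<union> (\<lambda>(r, y, y'). f y / (r * g y')) ` (insert 1 R \<times> Y \<times> Y)"
  have "finite C" using assms(1) Y(1) by (simp add: C_def)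
  from generic_rotation[OF this, of "f ` Y" "g ` Y"] obtain s where s: "norm s = 1" "s \<notin> C"
    and sum_s': "\<forall>k\<ge>1. (\<Sum>x\<in>f ` Y. x ^ k) + s ^ k * (\<Sum>x\<in>g ` Y. x ^ k) = 0
      \<longleftrightarrow> (\<Sum>x\<in>f ` Y. x ^ k) = 0 \<and> (\<Sum>x\<in>g ` Y. x ^ k) = 0"
    by (elim exE conjE) (rule that)
  note sum_s = sum_s'[rule_format]
  have s0: "s \<noteq> 0" using s by auto
  have cross: "f y \<noteq> r * (s * g y')" "s * g y' \<noteq> r * f y" if "r \<in> insert 1 R" "y \<in> Y" "y' \<in> Y" for r y y'
  proof -
    have nz: "f y \<noteq> 0" "g y' \<noteq> 0" using unit[OF f that(2)] unit[OF g that(3)] by auto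
    show "s * g y' \<noteq> r * f y"
    proof
      assume "s * g y' = r * f y"
      then have "s = r * f y / g y'" by (simp only: nonzero_eq_divide_eq[OF nz(2)])
      moreover have "r * f y / g y' \<in> C"
        unfolding C_def using that by (intro UnI1 image_eqI[of _ _ "(r, y, y')"]) simp_all
      ultimately show False using s(2) by blast
    qed
    show "f y \<noteq> r * (s * g y')"
    proof
      assume *: "f y = r * (s * g y')"
      then have "r * g y' \<noteq> 0" using nz by auto
      then have "s = (r * (s * g y')) / (r * g y')" by simp
      then have "s = f y / (r * g y')" unfolding * .
      moreover have "f y / (r * g y') \<in> C"
        unfolding C_def using that by (intro UnI2 image_eqI[of _ _ "(r, y, y')"]) simp_all
      ultimately show False using s(2) by blast
    qed
  qed
  define X where "X = f ` Y \<union> (\<lambda>x. s * x) ` (g ` Y)"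
  have sumX: "(\<Sum>x\<in>X. x ^ k) = (\<Sum>x\<in>f ` Y. x ^ k) + s ^ k * (\<Sum>x\<in>g ` Y. x ^ k)" for k
  proof -
    have "f ` Y \<inter> (\<lambda>x. s * x) ` (g ` Y) = {}" using cross(1)[of 1] by auto
    moreover have "inj_on (\<lambda>x. s * x) (g ` Y)" using s0 by (auto simp: inj_on_def)
    ultimately show ?thesis
      unfolding X_def using Y(1)
      by (subst sum.union_disjoint) (auto simp: sum.reindex sum_distrib_left power_mult_distrib)
  qed
  show ?thesis
  proof (intro exI conjI ballI allI impI)
    show "finite X" "X \<noteq> {}" using Y by (auto simp: X_def)
    show "X \<subseteq> sphere 0 1" using unit[OF f] unit[OF g] s(1) by (auto simp: X_def norm_mult)
  next
    fix k :: nat assume k: "k \<ge> 1"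
    have sumX_iff: "(\<Sum>x\<in>X. x ^ k) = 0 \<longleftrightarrow> (\<Sum>y\<in>Y. f y ^ k) = 0 \<and> (\<Sum>y\<in>Y. g y ^ k) = 0"
      using sum_s[OF k] unfolding sumX sum_root[OF f] sum_root[OF g] .
    show "(\<Sum>x\<in>X. x ^ k) = 0 \<longleftrightarrow> k = t"
    proof (cases "t dvd k")
      case True
      then obtain m where m: "k = t * m" by (rule dvdE)
      from True have "(\<Sum>x\<in>X. x ^ k) = 0 \<longleftrightarrow> (\<Sum>y\<in>Y. y ^ (k div t)) = 0"
        unfolding sumX_iff by (simp add: sum_root_dvd[OF f] sum_root_dvd[OF g])
      also have "k div t = m" using t by (simp add: m)
      also have "(\<Sum>y\<in>Y. y ^ m) = 0 \<longleftrightarrow> m = 1"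
        using k m by (intro sumY[rule_format]) (cases m, auto)
      also have "\<dots> \<longleftrightarrow> k = t" using t m by auto
      finally show ?thesis .
    next
      case False
      have "(\<Sum>y\<in>Y - {y0}. g y ^ k) = (\<Sum>y\<in>Y - {y0}. f y ^ k)"
        by (intro sum.cong) (auto simp: g_def)
      then have "(\<Sum>y\<in>Y. g y ^ k) - (\<Sum>y\<in>Y. f y ^ k) = (\<zeta> ^ k - 1) * f y0 ^ k"
        unfolding sum.remove[OF Y(1) y0] by (simp add: g_def power_mult_distrib algebra_simps)
      also have "\<dots> \<noteq> 0"
      proof -
        have "f y0 \<noteq> 0" using unit[OF f y0] by auto
        then show ?thesis using False zeta_power[of k] by simp
      qed
      finally have "(\<Sum>x\<in>X. x ^ k) \<noteq> 0"
        unfolding sumX_iff by auto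
      then show ?thesis using False by auto
    qed
  next
    fix x x' r assume x: "x \<in> X" "x' \<in> X" and r: "r \<in> R" and eq: "x = r * x'"
    from x consider (ff) y y' where "y \<in> Y" "y' \<in> Y" "x = f y" "x' = f y'"
      | (fg) y y' where "y \<in> Y" "y' \<in> Y" "x = f y" "x' = s * g y'"
      | (gf) y y' where "y \<in> Y" "y' \<in> Y" "x = s * g y" "x' = f y'"
      | (gg) y y' where "y \<in> Y" "y' \<in> Y" "x = s * g y" "x' = s * g y'"
      unfolding X_def by blast
    then show "x = x'"
    proof cases
      case ff
      show ?thesis using ratio[OF f ff(1,2) r] eq unfolding ff(3,4) by blast
    next
      case fg
      then show ?thesis using cross(1)[OF _ fg(1,2), of r] r eq by simp
    next
      case gf
      then show ?thesis using cross(2)[OF _ gf(2,1), of r] r eq by simp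
    next
      case gg
      then have "g y = r * g y'" using eq s0 by (simp add: mult.left_commute)
      then show ?thesis using ratio[OF g gg(1,2) r] unfolding gg(3,4) by simp
    qed
  qed
qed

section \<open>Product sets and induction on the prescribed orders\<close>

lemma exists_power_sum_zeros:
  assumes "finite T" "T \<subseteq> {1::nat..}"
  shows "\<exists>X :: complex set. finite X \<and> X \<noteq> {} \<and> X \<subseteq> sphere 0 1 \<and>
    {k. 1 \<le> k \<and> (\<Sum>x\<in>X. x ^ k) = 0} = T"
  using assms
proof (induction T)
  case empty
  show ?case by (intro exI[of _ "{1}"]) auto
next
  case (insert t T)
  then obtain B :: "complex set" where B: "finite B" "B \<noteq> {}" "B \<subseteq> sphere 0 1"
    "{k. 1 \<le> k \<and> (\<Sum>x\<in>B. x ^ k) = 0} = T" by auto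
  have t: "t \<ge> 1" using insert.prems by auto
  \<comment> \<open>An equation \<open>b * x = b' * x'\<close> gives \<open>x\<close> and
    \<open>x'\<close> the ratio \<open>b' / b\<close>. When \<open>X\<close> avoids these ratios,
    multiplication is injective on \<open>B \<times> X\<close> and the power sums factor.\<close>
  have "finite ((\<lambda>(b, b'). b' / b) ` (B \<times> B))" using B by simp
  from exists_singleton_strength[OF this t] obtain X where X: "finite X" "X \<noteq> {}" "X \<subseteq> sphere 0 1"
    "\<forall>k\<ge>1. (\<Sum>x\<in>X. x ^ k) = 0 \<longleftrightarrow> k = t"
    "\<forall>x\<in>X. \<forall>x'\<in>X. \<forall>r\<in>(\<lambda>(b, b'). b' / b) ` (B \<times> B). x = r * x' \<longrightarrow> x = x'"
    by (elim exE conjE) (rule that)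
  let ?m = "\<lambda>(b, x). b * x :: complex"
  have nz: "b \<noteq> 0" if "b \<in> B \<union> X" for b using that B(3) X(3) by auto
  have inj: "inj_on ?m (B \<times> X)"
  proof (rule inj_onI, clarify)
    fix b x b' x'
    assume *: "b \<in> B" "x \<in> X" "b' \<in> B" "x' \<in> X" "b * x = b' * x'"
    have "x = (b * x) / b" using nz[of b] *(1) by simp
    also have "\<dots> = (b' / b) * x'" unfolding *(5) by simp
    finally have "x = (b' / b) * x'" .
    moreover have "b' / b \<in> (\<lambda>(b, b'). b' / b) ` (B \<times> B)" using *(1,3) by force
    ultimately have "x = x'" using X(5) *(2,4) by blast
    then show "b = b' \<and> x = x'" using * nz[of x'] by simp
  qed
  have "(\<Sum>z\<in>?m ` (B \<times> X). z ^ k) = (\<Sum>b\<in>B. b ^ k) * (\<Sum>x\<in>X. x ^ k)" for k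
    unfolding sum.reindex[OF inj] sum_product sum.cartesian_product
    by (intro sum.cong) (auto simp: power_mult_distrib)
  then have "{k. 1 \<le> k \<and> (\<Sum>z\<in>?m ` (B \<times> X). z ^ k) = 0} = insert t T"
    using B(4) X(4) t by auto
  moreover have "?m ` (B \<times> X) \<subseteq> sphere 0 1"
    using B(3) X(3) by (auto simp: norm_mult subset_iff)
  moreover have "finite (?m ` (B \<times> X))" "?m ` (B \<times> X) \<noteq> {}" using B X by auto
  ultimately show ?case by blast
qed

theorem theoremB:
  fixes T :: "nat set"
  assumes "finite T" and "T \<subseteq> {1..}"
  shows "\<exists>X :: complex set. finite X \<and> X \<noteq> {} \<and> X \<subseteq> sphere 0 1 \<and> Hst X = T"
  unfolding Hst_complex using assms by (rule exists_power_sum_zeros)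

end
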